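(* Let $\{\mathcal{G}_j : j \in J\}$ be an HS-frame for $\mathbb{H}$ with respect to $\mathbb{K}$ and let $\{\varGamma_j : j \in J\}$ be an alternate dual HS-frame of $\{\mathcal{G}_j : j \in J\}$. Then for any $\lambda \in [0,1]$, all $K \subset J$ and all $f \in \mathbb{H}$, \begin{eqnarray*} && \mathrm{Re} \bigg\{ \sum_{j \in K^c} \big[ \varGamma_j (f),\mathcal{G}_j (f) \big]_{\tau} \bigg\}+ \bigg\Vert \sum_{j \in K} \mathcal{G}_j^* \varGamma_j (f) \bigg\Vert^2 \\ &=& \mathrm{Re} \bigg\{ \sum_{j \in K} \big[ \varGamma_j (f),\mathcal{G}_j (f) \big]_{\tau} \bigg\}+ \bigg\Vert \sum_{j \in K^c} \mathcal{G}_j^* \varGamma_j (f) \bigg\Vert^2 \\ & \geq & (2 \lambda - \lambda^2)\, \mathrm{Re} \bigg\{ \sum_{j \in K} \big[ \varGamma_j (f),\mathcal{G}_j (f) \big]_{\tau} \bigg\}+(1-\lambda^2)\, \mathrm{Re} \bigg\{ \sum_{j \in K^c} \big[ \varGamma_j (f),\mathcal{G}_j (f) \big]_{\tau} \bigg\}. \end{eqnarray*}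
   Context: $\mathbb{H}$ and $\mathbb{K}$ are complex Hilbert spaces, $J$ is a countable index set, and $K^c = J \setminus K$ for $K \subset J$. $C_2 \subseteq \mathcal{L}(\mathbb{K})$ denotes the Hilbert-Schmidt class of operators on $\mathbb{K}$, a Hilbert space with inner product $[T,S]_\tau = \tau(S^*T)$ ($\tau$ the usual trace) and norm $\Vert T\Vert_2 = [T,T]_\tau^{1/2}$. A family $\{\mathcal{G}_j : j \in J\}$ of bounded linear operators from $\mathbb{H}$ to $C_2 \subseteq \mathcal{L}(\mathbb{K})$ is a Hilbert-Schmidt frame (HS-frame) for $\mathbb{H}$ with respect to $\mathbb{K}$ if there are constants $A,B>0$ such that $A\Vert f\Vert^2 \le \sum_{j\in J}\Vert \mathcal{G}_j(f)\Vert_2^2 \le B\Vert f\Vert^2$ for all $f\in\mathbb{H}$. $\mathcal{G}_j^*: C_2 \to \mathbb{H}$ is the adjoint of $\mathcal{G}_j$. An HS-frame $\{\varGamma_j : j\in J\}$ for $\mathbb{H}$ with respect to $\mathbb{K}$ is an alternate dual HS-frame of $\{\mathcal{G}_j : j\in J\}$ if $f=\sum_{j\in J}\mathcal{G}_j^*\varGamma_j f=\sum_{j\in J}\varGamma_j^*\mathcal{G}_j f$ for all $f\in\mathbb{H}$. Series are understood as unconditionally convergent. *)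

theory Defs
  imports "HOL-Analysis.Analysis"
begin

text \<open>Complex Hilbert spaces are built on top of the real ones: \<open>inner\<close> is required to be the
  real part of \<open>cinner\<close>, so norm, topology and completeness are those of the underlying
  real Hilbert space.  The complex inner product is linear in the first argument.\<close>

class complex_inner = real_inner +
  fixes scaleC :: "complex \<Rightarrow> 'a \<Rightarrow> 'a" (infixr "*\<^sub>C" 75)
    and cinner :: "'a \<Rightarrow> 'a \<Rightarrow> complex"
  assumes scaleC_add_right: "a *\<^sub>C (x + y) = a *\<^sub>C x + a *\<^sub>C y"
    and scaleC_add_left: "(a + b) *\<^sub>C x = a *\<^sub>C x + b *\<^sub>C x"
    and scaleC_scaleC: "a *\<^sub>C (b *\<^sub>C x) = (a * b) *\<^sub>C x"
    and scaleC_of_real: "complex_of_real r *\<^sub>C x = r *\<^sub>R x"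
    and cinner_add_left: "cinner (x + y) z = cinner x z + cinner y z"
    and cinner_scaleC_left: "cinner (a *\<^sub>C x) y = a * cinner x y"
    and cinner_commute: "cinner x y = cnj (cinner y x)"
    and Re_cinner: "Re (cinner x y) = inner x y"

class complex_hilbert = complex_inner + complete_space

instantiation complex :: complex_hilbert
begin

definition scaleC_complex :: "complex \<Rightarrow> complex \<Rightarrow> complex"
  where "scaleC_complex a x = a * x"

definition cinner_complex :: "complex \<Rightarrow> complex \<Rightarrow> complex"
  where "cinner_complex x y = x * cnj y"

instance
  by standard
    (auto simp: scaleC_complex_def cinner_complex_def algebra_simps scaleR_conv_of_real
      inner_complex_def)

end

text \<open>An orthonormal basis (Hilbert basis) is a maximal orthonormal set.\<close>

definition orthonormal :: "'a::complex_inner set \<Rightarrow> bool"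
  where "orthonormal E \<longleftrightarrow>
    (\<forall>e\<in>E. \<forall>e'\<in>E. cinner e e' = (if e = e' then 1 else 0))"

definition is_onb :: "'a::complex_inner set \<Rightarrow> bool"
  where "is_onb E \<longleftrightarrow> orthonormal E \<and> (\<forall>F. orthonormal F \<longrightarrow> E \<subseteq> F \<longrightarrow> F = E)"

lemma ex_onb: "\<exists>E :: 'a::complex_inner set. is_onb E"
proof -
  have "\<exists>M\<in>{E :: 'a set. orthonormal E}. \<forall>X\<in>{E. orthonormal E}. M \<subseteq> X \<longrightarrow> X = M"
  proof (rule subset_Zorn_nonempty)
    show "{E :: 'a set. orthonormal E} \<noteq> {}"
      by (auto simp: orthonormal_def intro: exI[of _ "{}"])
  next
    fix \<C> :: "'a set set"
    assume "\<C> \<noteq> {}" and chain: "subset.chain {E. orthonormal E} \<C>"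
    have "cinner e e' = (if e = e' then 1 else 0)"
      if "e \<in> X" "X \<in> \<C>" "e' \<in> Y" "Y \<in> \<C>" for e e' X Y
    proof -
      have "X \<subseteq> Y \<or> Y \<subseteq> X" "orthonormal X" "orthonormal Y"
        using chain that by (auto simp: subset.chain_def)
      then show ?thesis
        using that unfolding orthonormal_def by blast
    qed
    then show "\<Union>\<C> \<in> {E. orthonormal E}"
      by (auto simp: orthonormal_def)
  qed
  then show ?thesis
    by (auto simp: is_onb_def)
qed

definition bounded_clinear :: "('a::complex_inner \<Rightarrow> 'b::complex_inner) \<Rightarrow> bool"
  where "bounded_clinear T \<longleftrightarrow> bounded_linear T \<and> (\<forall>c x. T (c *\<^sub>C x) = c *\<^sub>C T x)"

text \<open>The adjoint of a bounded operator between Hilbert spaces exists and is unique by Riesz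
  representation.\<close>

definition cadjoint :: "('a::complex_inner \<Rightarrow> 'b::complex_inner) \<Rightarrow> 'b \<Rightarrow> 'a"
  where "cadjoint T = (THE S. \<forall>x y. cinner (T x) y = cinner x (S y))"

text \<open>The trace of a trace class operator does not depend on the orthonormal basis, and one
  exists by \<open>ex_onb\<close>.\<close>

definition trace_op :: "('a::complex_inner \<Rightarrow> 'a) \<Rightarrow> complex"
  where "trace_op T = (\<Sum>\<^sub>\<infinity>e\<in>(SOME E. is_onb E). cinner (T e) e)"

text \<open>The Hilbert-Schmidt class \<open>C\<^sub>2\<close>; square summability along one orthonormal basis is
  equivalent to square summability along all of them.\<close>

definition HS_class :: "('k::complex_hilbert \<Rightarrow> 'k) set"
  where "HS_class = {T. bounded_clinear T \<and>
    (\<exists>E. is_onb E \<and> (\<lambda>e. (norm (T e))\<^sup>2) summable_on E)}"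

definition HS_inner :: "('k::complex_hilbert \<Rightarrow> 'k) \<Rightarrow> ('k \<Rightarrow> 'k) \<Rightarrow> complex"
  where "HS_inner T S = trace_op (cadjoint S \<circ> T)"

definition HS_norm :: "('k::complex_hilbert \<Rightarrow> 'k) \<Rightarrow> real"
  where "HS_norm T = sqrt (Re (HS_inner T T))"

text \<open>Bounded linear operators from \<open>'h\<close> to \<open>C\<^sub>2\<close>; the vector space operations of
  \<open>C\<^sub>2\<close> are pointwise and its norm is \<open>HS_norm\<close>.\<close>

definition bounded_clinear_HS :: "('h::complex_hilbert \<Rightarrow> 'k::complex_hilbert \<Rightarrow> 'k) \<Rightarrow> bool"
  where "bounded_clinear_HS G \<longleftrightarrow>
    (\<forall>f. G f \<in> HS_class) \<and>
    (\<forall>f g. G (f + g) = (\<lambda>x. G f x + G g x)) \<and>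
    (\<forall>c f. G (c *\<^sub>C f) = (\<lambda>x. c *\<^sub>C G f x)) \<and>
    (\<exists>C. \<forall>f. HS_norm (G f) \<le> C * norm f)"

text \<open>The adjoint \<open>C\<^sub>2 \<rightarrow> 'h\<close> of such an operator; it is only meaningful on arguments in
  \<open>HS_class\<close>.\<close>

definition adjoint_HS :: "('h::complex_hilbert \<Rightarrow> 'k::complex_hilbert \<Rightarrow> 'k) \<Rightarrow> ('k \<Rightarrow> 'k) \<Rightarrow> 'h"
  where "adjoint_HS G T = (THE h. \<forall>f. HS_inner (G f) T = cinner f h)"

definition HS_frame :: "'j set \<Rightarrow> ('j \<Rightarrow> 'h::complex_hilbert \<Rightarrow> 'k::complex_hilbert \<Rightarrow> 'k) \<Rightarrow> bool"
  where "HS_frame J G \<longleftrightarrow>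
    (\<forall>j\<in>J. bounded_clinear_HS (G j)) \<and>
    (\<exists>A>0. \<exists>B>0. \<forall>f.
      (\<lambda>j. (HS_norm (G j f))\<^sup>2) summable_on J \<and>
      A * (norm f)\<^sup>2 \<le> (\<Sum>\<^sub>\<infinity>j\<in>J. (HS_norm (G j f))\<^sup>2) \<and>
      (\<Sum>\<^sub>\<infinity>j\<in>J. (HS_norm (G j f))\<^sup>2) \<le> B * (norm f)\<^sup>2)"

text \<open>Unconditional convergence is expressed by \<open>has_sum\<close>.\<close>

definition alternate_dual_HS_frame ::
  "'j set \<Rightarrow> ('j \<Rightarrow> 'h::complex_hilbert \<Rightarrow> 'k::complex_hilbert \<Rightarrow> 'k) \<Rightarrow>
    ('j \<Rightarrow> 'h \<Rightarrow> 'k \<Rightarrow> 'k) \<Rightarrow> bool"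
  where "alternate_dual_HS_frame J G \<Gamma> \<longleftrightarrow>
    HS_frame J \<Gamma> \<and>
    (\<forall>f. ((\<lambda>j. adjoint_HS (G j) (\<Gamma> j f)) has_sum f) J \<and>
         ((\<lambda>j. adjoint_HS (\<Gamma> j) (G j f)) has_sum f) J)"

end

theory Submission
  imports Defs
begin

text \<open>By duality the sums \<open>u\<close> and \<open>v\<close> of \<open>G\<^sub>j\<^sup>* \<Gamma>\<^sub>j f\<close> over \<open>K\<close> and its complement add up to
  \<open>f\<close>, and the real parts in the statement are \<open>inner u f\<close> and \<open>inner v f\<close>.  The equality is then
  bilinearity, and the two sides of the inequality differ by the square of
  \<open>norm ((1 - lam) *\<^sub>R u - lam *\<^sub>R v)\<close>.  The analytic content is that the adjoints,
  which are defined by description, really exist: this is Riesz representation, obtained here from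
  expansion in an orthonormal basis, together with the independence of square summability from the
  basis.\<close>

subclass (in complex_hilbert) banach ..

subsection \<open>Complex inner products\<close>

lemma cinner_add_right: "cinner x (y + z) = cinner x y + cinner x z"
  by (metis cinner_add_left cinner_commute complex_cnj_add)

lemma cinner_scaleC_right: "cinner x (a *\<^sub>C y) = cnj a * cinner x y"
  by (metis cinner_commute cinner_scaleC_left complex_cnj_mult)

lemma cinner_scaleR_left: "cinner (r *\<^sub>R x) y = complex_of_real r * cinner x y"
  by (metis cinner_scaleC_left scaleC_of_real)

lemma cinner_scaleR_right: "cinner x (r *\<^sub>R y) = complex_of_real r * cinner x y"
  by (metis cinner_scaleC_right complex_cnj_complex_of_real scaleC_of_real)

lemma cinner_self: "cinner x x = complex_of_real ((norm x)\<^sup>2)"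
proof (rule complex_eqI)
  show "Re (cinner x x) = Re (complex_of_real ((norm x)\<^sup>2))"
    by (simp add: Re_cinner power2_norm_eq_inner)
  have "Im (cinner x x) = - Im (cinner x x)"
    using cinner_commute[of x x] by (metis cnj.simps(2))
  then show "Im (cinner x x) = Im (complex_of_real ((norm x)\<^sup>2))"
    by simp
qed

lemma norm_scaleC: "norm (a *\<^sub>C x) = cmod a * norm x"
proof -
  have "complex_of_real ((norm (a *\<^sub>C x))\<^sup>2) = complex_of_real ((cmod a * norm x)\<^sup>2)"
    unfolding cinner_self[symmetric] cinner_scaleC_left cinner_scaleC_right
    by (simp add: cinner_self power_mult_distrib complex_norm_square mult.assoc del: of_real_power)
  then have "(norm (a *\<^sub>C x))\<^sup>2 = (cmod a * norm x)\<^sup>2"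
    using of_real_eq_iff by blast
  then show ?thesis
    by simp
qed

text \<open>Rotating \<open>x\<close> by a unimodular scalar turns \<open>cinner x y\<close> into
  its absolute value, so the real Cauchy-Schwarz inequality applies.\<close>

lemma complex_Cauchy_Schwarz: "cmod (cinner x y) \<le> norm x * norm y"
proof (cases "cinner x y = 0")
  case False
  define c where "c = cnj (sgn (cinner x y))"
  have c: "cmod c = 1"
    using False by (simp add: c_def norm_sgn)
  have "c * cinner x y = complex_of_real (cmod (cinner x y))"
    using False complex_norm_square[of "cinner x y"]
    by (simp add: c_def sgn_eq field_simps power2_eq_square)
  then have "cmod (cinner x y) = inner (c *\<^sub>C x) y"
    by (metis Re_cinner Re_complex_of_real cinner_scaleC_left)
  also have "\<dots> \<le> norm (c *\<^sub>C x) * norm y"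
    by (rule norm_cauchy_schwarz)
  finally show ?thesis
    by (simp add: norm_scaleC c)
qed simp

lemma bounded_linear_cinner_left: "bounded_linear (\<lambda>x. cinner x y)"
  by (rule bounded_linear_intro[where K = "norm y"])
    (auto simp: cinner_add_left cinner_scaleR_left scaleR_conv_of_real complex_Cauchy_Schwarz)

lemma bounded_linear_cinner_right: "bounded_linear (\<lambda>y. cinner x y)"
  by (rule bounded_linear_intro[where K = "norm x"])
    (auto simp: cinner_add_right cinner_scaleR_right scaleR_conv_of_real,
      metis complex_Cauchy_Schwarz mult.commute)

text \<open>Supplies the uniqueness half of the definite descriptions in \<open>cadjoint\<close> and
  \<open>adjoint_HS\<close>.\<close>

lemma cinner_right_unique:
  assumes "\<And>x. cinner x h = cinner x h'"
  shows "h = h'"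
proof -
  have "inner x h = inner x h'" for x
    by (metis Re_cinner assms)
  then show ?thesis
    by (metis inner_commute vector_eq_rdot)
qed

subsection \<open>Orthonormal bases and the Riesz representation theorem\<close>

text \<open>The net of finite partial sums is Cauchy: by Pythagoras the squared norm of a finite
  tail equals a tail of the convergent series of squares. Completeness gives the limit.\<close>

lemma summable_on_orthogonal:
  fixes f :: "'i \<Rightarrow> 'a::{real_inner, banach}"
  assumes orth: "pairwise (\<lambda>i j. orthogonal (f i) (f j)) A"
    and sq: "(\<lambda>i. (norm (f i))\<^sup>2) summable_on A"
  shows "f summable_on A"
proof -
  let ?n = "\<lambda>i. (norm (f i))\<^sup>2"
  have "\<exists>P. eventually P (finite_subsets_at_top A) \<and>
      (\<forall>F F'. P F \<and> P F' \<longrightarrow> dist (sum f F) (sum f F') < e)" if "e > 0" for e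
  proof -
    \<comment> \<open>With tolerance \<open>(e/3)\<^sup>2\<close> each finite tail has norm at most
      \<open>e/3\<close>, so two partial sums beyond \<open>F0\<close> differ by at most two thirds
      of \<open>e\<close>, hence strictly less than \<open>e\<close>.\<close>
    obtain F0 where F0: "finite F0" "F0 \<subseteq> A" "dist (sum ?n F0) (infsum ?n A) \<le> (e/3)\<^sup>2"
      using has_sum_finite_approximation[OF has_sum_infsum[OF sq], of "(e/3)\<^sup>2"] \<open>e > 0\<close> by auto
    let ?P = "\<lambda>F. finite F \<and> F0 \<subseteq> F \<and> F \<subseteq> A"
    have tail: "dist (sum f F) (sum f F0) \<le> e/3" if "?P F" for F
    proof -
      have "(norm (sum f (F - F0)))\<^sup>2 = sum ?n (F - F0)"
        using that orth by (intro norm_sum_Pythagorean) (auto simp: pairwise_def)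
      also have "\<dots> = sum ?n F - sum ?n F0"
        using that by (intro sum_diff) auto
      also have "\<dots> \<le> infsum ?n A - sum ?n F0"
        using that finite_sum_le_infsum[OF sq, of F] by auto
      also have "\<dots> \<le> (e/3)\<^sup>2"
        using F0 by (auto simp: dist_real_def)
      finally have "norm (sum f (F - F0)) \<le> e/3"
        by (rule power2_le_imp_le) (use \<open>e > 0\<close> in auto)
      then show ?thesis
        using that by (simp add: dist_norm sum_diff)
    qed
    have "dist (sum f F) (sum f F') < e" if "?P F" "?P F'" for F F'
      using tail[OF that(1)] tail[OF that(2)] \<open>e > 0\<close>
        dist_triangle2[of "sum f F" "sum f F'" "sum f F0"] by linarith
    moreover have "eventually ?P (finite_subsets_at_top A)"
      using F0 by (auto simp: eventually_finite_subsets_at_top)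
    ultimately show ?thesis
      by (intro exI[where x = ?P] conjI allI impI) auto
  qed
  then have "cauchy_filter (filtermap (sum f) (finite_subsets_at_top A))"
    by (simp add: cauchy_filter_metric_filtermap)
  moreover have "complete (UNIV :: 'a set)"
    by (meson Cauchy_convergent UNIV_I complete_def convergent_def)
  ultimately obtain L where "(sum f \<longlongrightarrow> L) (finite_subsets_at_top A)"
    using complete_uniform[where S = "UNIV :: 'a set"] by (force simp: filterlim_def)
  then show ?thesis
    using summable_on_def has_sum_def by blast
qed

lemma orthonormal_norm:
  assumes "orthonormal E" "e \<in> E"
  shows "norm e = 1"
proof -
  have "complex_of_real ((norm e)\<^sup>2) = 1"
    using assms unfolding cinner_self[symmetric] by (simp add: orthonormal_def)
  then have "(norm e)\<^sup>2 = 1"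
    using of_real_eq_1_iff by blast
  then show ?thesis
    using power2_eq_1_iff[of "norm e"] norm_ge_zero[of e] by linarith
qed

lemma orthonormal_scaled_orthogonal:
  assumes "orthonormal E"
  shows "pairwise (\<lambda>e e'. orthogonal (c e *\<^sub>C e) (c e' *\<^sub>C e')) E"
  using assms
  by (auto simp: pairwise_def orthogonal_def Re_cinner[symmetric] cinner_scaleC_left
      cinner_scaleC_right orthonormal_def)

lemma norm_orthonormal_sum:
  assumes "orthonormal E" "finite F" "F \<subseteq> E"
  shows "(norm (\<Sum>e\<in>F. c e *\<^sub>C e))\<^sup>2 = (\<Sum>e\<in>F. (cmod (c e))\<^sup>2)"
proof -
  have "(norm (\<Sum>e\<in>F. c e *\<^sub>C e))\<^sup>2 = (\<Sum>e\<in>F. (norm (c e *\<^sub>C e))\<^sup>2)"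
    using assms pairwise_subset[OF orthonormal_scaled_orthogonal[OF assms(1), of c], of F]
    by (intro norm_sum_Pythagorean) auto
  also have "\<dots> = (\<Sum>e\<in>F. (cmod (c e))\<^sup>2)"
    using assms by (intro sum.cong) (auto simp: norm_scaleC orthonormal_norm subset_iff)
  finally show ?thesis .
qed

lemma orthonormal_summable:
  fixes E :: "'a::complex_hilbert set"
  assumes "orthonormal E" "(\<lambda>e. (cmod (c e))\<^sup>2) summable_on E"
  shows "(\<lambda>e. c e *\<^sub>C e) summable_on E"
proof (rule summable_on_orthogonal[OF orthonormal_scaled_orthogonal[OF assms(1)]])
  show "(\<lambda>e. (norm (c e *\<^sub>C e))\<^sup>2) summable_on E"
    using assms by (subst summable_on_cong[where g = "\<lambda>e. (cmod (c e))\<^sup>2"])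
      (auto simp: norm_scaleC orthonormal_norm)
qed

text \<open>Expand the nonnegative square of \<open>norm (x - y)\<close>, where \<open>y\<close> is
  the orthogonal projection of \<open>x\<close> onto the span of \<open>F\<close>; both
  \<open>inner x y\<close> and \<open>(norm y)\<^sup>2\<close> equal the coefficient sum.\<close>

lemma Bessel_inequality:
  assumes "orthonormal E" "finite F" "F \<subseteq> E"
  shows "(\<Sum>e\<in>F. (cmod (cinner x e))\<^sup>2) \<le> (norm x)\<^sup>2"
proof -
  define y where "y = (\<Sum>e\<in>F. cinner x e *\<^sub>C e)"
  define s where "s = (\<Sum>e\<in>F. (cmod (cinner x e))\<^sup>2)"
  have "cinner x y = (\<Sum>e\<in>F. cinner x (cinner x e *\<^sub>C e))"
    unfolding y_def by (rule linear_sum[OF bounded_linear.linear[OF bounded_linear_cinner_right]])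
  also have "\<dots> = complex_of_real s"
    by (simp add: s_def cinner_scaleC_right complex_norm_square mult.commute del: of_real_power)
  finally have xy: "inner x y = s"
    by (metis Re_cinner Re_complex_of_real)
  have "(norm y)\<^sup>2 = s"
    unfolding y_def s_def by (rule norm_orthonormal_sum[OF assms])
  moreover have "(norm (x - y))\<^sup>2 = (norm x)\<^sup>2 - 2 * inner x y + (norm y)\<^sup>2"
    by (simp add: power2_norm_eq_inner inner_diff inner_commute)
  ultimately show ?thesis
    using xy zero_le_power2[of "norm (x - y)"] unfolding s_def by linarith
qed

lemma Bessel_summable:
  assumes "orthonormal E"
  shows "(\<lambda>e. (cmod (cinner x e))\<^sup>2) summable_on E"
  by (rule nonneg_bdd_above_summable_on)
    (auto intro!: bdd_aboveI[where M = "(norm x)\<^sup>2"] Bessel_inequality[OF assms])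

section \<open>Fourier expansion in an orthonormal basis\<close>

text \<open>A nonzero \<open>r\<close> could be normalized and adjoined to \<open>E\<close>, against
  maximality.\<close>

lemma is_onb_orthogonal_eq_0:
  assumes "is_onb E" "\<And>e. e \<in> E \<Longrightarrow> cinner r e = 0"
  shows "r = 0"
proof (rule ccontr)
  assume "r \<noteq> 0"
  define u where "u = (1 / norm r) *\<^sub>R r"
  have E: "orthonormal E" and max: "\<And>F. orthonormal F \<Longrightarrow> E \<subseteq> F \<Longrightarrow> F = E"
    using assms(1) by (auto simp: is_onb_def)
  have u1: "cinner u u = 1"
    using \<open>r \<noteq> 0\<close> by (simp add: u_def cinner_self)
  have u2: "cinner u e = 0" "cinner e u = 0" if "e \<in> E" for e
  proof -
    show "cinner u e = 0"
      using assms(2)[OF that] by (simp add: u_def cinner_scaleR_left)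
    then show "cinner e u = 0"
      using cinner_commute[of e u] by simp
  qed
  have "u \<notin> E"
    using u1 u2 by force
  moreover have "orthonormal (insert u E)"
    using E u1 u2 \<open>u \<notin> E\<close> by (auto simp: orthonormal_def)
  ultimately show False
    using max[of "insert u E"] by auto
qed

text \<open>Bessel's inequality makes the series converge to some \<open>y\<close>; then
  \<open>x - y\<close> is orthogonal to all of \<open>E\<close> and therefore vanishes.\<close>

lemma onb_expansion:
  fixes x :: "'a::complex_hilbert"
  assumes "is_onb E"
  shows "((\<lambda>e. cinner x e *\<^sub>C e) has_sum x) E"
proof -
  have E: "orthonormal E"
    using assms by (simp add: is_onb_def)
  obtain y where y: "((\<lambda>e. cinner x e *\<^sub>C e) has_sum y) E"
    using orthonormal_summable[OF E Bessel_summable[OF E]] by (auto simp: summable_on_def)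
  have "cinner (x - y) e = 0" if "e \<in> E" for e
  proof -
    have "((\<lambda>e'. cinner (cinner x e' *\<^sub>C e') e) has_sum cinner y e) E"
      by (rule has_sum_bounded_linear[OF bounded_linear_cinner_left y])
    moreover have "((\<lambda>e'. cinner (cinner x e' *\<^sub>C e') e) has_sum cinner x e) E"
    proof (subst has_sum_cong_neutral[where T = "{e}" and g = "\<lambda>e'. cinner x e"])
      show "((\<lambda>e'. cinner x e) has_sum cinner x e) {e}"
        by (simp add: has_sum_finiteI)
    qed (use E that in \<open>auto simp: cinner_scaleC_left orthonormal_def\<close>)
    ultimately have "cinner y e = cinner x e"
      by (rule has_sum_unique)
    then show ?thesis
      using cinner_add_left[of "x - y" y e] by simp
  qed
  then have "x - y = 0"
    by (rule is_onb_orthogonal_eq_0[OF assms])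
  then show ?thesis
    using y by simp
qed

lemma Parseval:
  fixes x :: "'a::complex_hilbert"
  assumes "is_onb E"
  shows "((\<lambda>e. (cmod (cinner x e))\<^sup>2) has_sum (norm x)\<^sup>2) E"
proof -
  have "((\<lambda>e. inner (cinner x e *\<^sub>C e) x) has_sum inner x x) E"
    by (rule has_sum_bounded_linear[OF bounded_linear_inner_left onb_expansion[OF assms]])
  moreover have "inner (cinner x e *\<^sub>C e) x = (cmod (cinner x e))\<^sup>2" for e
  proof -
    have "cinner (cinner x e *\<^sub>C e) x = complex_of_real ((cmod (cinner x e))\<^sup>2)"
      using cinner_commute[of e x]
      by (simp add: cinner_scaleC_left complex_norm_square del: of_real_power)
    then show ?thesis
      by (metis Re_cinner Re_complex_of_real)
  qed
  ultimately show ?thesis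
    by (simp add: power2_norm_eq_inner)
qed

section \<open>Riesz representation and adjoints of bounded operators\<close>

text \<open>The representing vector must have the coefficients \<open>cnj (\<phi> e)\<close>.
  Boundedness of \<open>\<phi>\<close> makes them square summable, and the basis expansion of
  \<open>x\<close> then identifies \<open>\<phi> x\<close>.\<close>

lemma Riesz_representation:
  fixes \<phi> :: "'a::complex_hilbert \<Rightarrow> complex"
  assumes "bounded_clinear \<phi>"
  shows "\<exists>h. \<forall>x. \<phi> x = cinner x h"
proof -
  obtain E :: "'a set" where onb: "is_onb E"
    using ex_onb by blast
  then have E: "orthonormal E"
    by (simp add: is_onb_def)
  have lin: "bounded_linear \<phi>" and scale: "\<And>c x. \<phi> (c *\<^sub>C x) = c * \<phi> x"
    using assms by (auto simp: bounded_clinear_def scaleC_complex_def)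
  obtain C where C: "\<And>x. cmod (\<phi> x) \<le> norm x * C"
    using bounded_linear.bounded[OF lin] by blast
  have bound: "(\<Sum>e\<in>F. (cmod (\<phi> e))\<^sup>2) \<le> C\<^sup>2" if F: "finite F" "F \<subseteq> E" for F
  proof -
    \<comment> \<open>A finite section of the future \<open>h\<close>. It satisfies
      \<open>\<phi> y = (norm y)\<^sup>2\<close>, so the bound on \<open>\<phi>\<close> at
      \<open>y\<close> becomes a bound on \<open>norm y\<close>.\<close>
    define y where "y = (\<Sum>e\<in>F. cnj (\<phi> e) *\<^sub>C e)"
    define s where "s = (\<Sum>e\<in>F. (cmod (\<phi> e))\<^sup>2)"
    have s: "(norm y)\<^sup>2 = s"
      unfolding y_def s_def using norm_orthonormal_sum[OF E F, of "\<lambda>e. cnj (\<phi> e)"] by simp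
    have "\<phi> y = (\<Sum>e\<in>F. \<phi> (cnj (\<phi> e) *\<^sub>C e))"
      unfolding y_def by (rule linear_sum[OF bounded_linear.linear[OF lin]])
    also have "\<dots> = complex_of_real s"
      by (simp add: s_def scale complex_norm_square mult.commute del: of_real_power)
    finally have "\<bar>s\<bar> \<le> norm y * C"
      using C[of y] by simp
    then have "norm y * norm y \<le> norm y * C"
      using s by (simp add: power2_eq_square)
    then have "norm y \<le> C \<or> norm y = 0"
      by (auto simp: mult_le_cancel_left)
    then have "(norm y)\<^sup>2 \<le> C\<^sup>2"
      by (auto intro: power_mono)
    then show ?thesis
      using s by (simp add: s_def)
  qed
  have "(\<lambda>e. (cmod (cnj (\<phi> e)))\<^sup>2) summable_on E"
    using bound by (intro nonneg_bdd_above_summable_on) (auto intro!: bdd_aboveI[where M = "C\<^sup>2"])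
  then obtain h where h: "((\<lambda>e. cnj (\<phi> e) *\<^sub>C e) has_sum h) E"
    using orthonormal_summable[OF E, of "\<lambda>e. cnj (\<phi> e)"] unfolding summable_on_def by blast
  have "\<phi> x = cinner x h" for x
  proof (rule has_sum_unique)
    show "((\<lambda>e. \<phi> (cinner x e *\<^sub>C e)) has_sum \<phi> x) E"
      by (rule has_sum_bounded_linear[OF lin onb_expansion[OF onb]])
    show "((\<lambda>e. \<phi> (cinner x e *\<^sub>C e)) has_sum cinner x h) E"
      using has_sum_bounded_linear[OF bounded_linear_cinner_right h, of x]
      by (simp add: scale cinner_scaleC_right mult.commute)
  qed
  then show ?thesis
    by blast
qed

text \<open>For each \<open>y\<close>, Riesz representation of the functional
  \<open>\<lambda>x. cinner (T x) y\<close> yields the value at \<open>y\<close>; uniqueness then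
  shows that the description denotes this map.\<close>

lemma cinner_cadjoint:
  fixes T :: "'a::complex_hilbert \<Rightarrow> 'b::complex_hilbert"
  assumes "bounded_clinear T"
  shows "cinner (T x) y = cinner x (cadjoint T y)"
proof -
  have lin: "bounded_linear T" and scale: "\<And>c x. T (c *\<^sub>C x) = c *\<^sub>C T x"
    using assms by (auto simp: bounded_clinear_def)
  have "bounded_clinear (\<lambda>x. cinner (T x) y)" for y
    using bounded_linear_compose[OF bounded_linear_cinner_left lin]
    by (simp add: bounded_clinear_def scale cinner_scaleC_left scaleC_complex_def)
  then have "\<forall>y. \<exists>h. \<forall>x. cinner (T x) y = cinner x h"
    using Riesz_representation by blast
  then obtain S where S: "\<forall>x y. cinner (T x) y = cinner x (S y)"
    by metis
  have "\<forall>x y. cinner (T x) y = cinner x (cadjoint T y)"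
    unfolding cadjoint_def
  proof (rule theI[where P = "\<lambda>S. \<forall>x y. cinner (T x) y = cinner x (S y)", OF S])
    fix S' assume S': "\<forall>x y. cinner (T x) y = cinner x (S' y)"
    have "S' y = S y" for y
      by (rule cinner_right_unique) (simp add: S[rule_format, symmetric] S'[rule_format, symmetric])
    then show "S' = S"
      by blast
  qed
  then show ?thesis
    by blast
qed

subsection \<open>The Hilbert-Schmidt inner product\<close>

text \<open>Applied twice, to the pairs \<open>T, S\<close> and \<open>S, T\<close>, this makes square summability
  independent of the orthonormal basis.\<close>

lemma adjoint_square_summable:
  fixes T :: "'a::complex_hilbert \<Rightarrow> 'b::complex_hilbert"
  assumes adj: "\<And>x y. cinner (T x) y = cinner x (S y)"
    and E: "is_onb E" and D: "orthonormal D"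
    and sq: "(\<lambda>e. (norm (T e))\<^sup>2) summable_on E"
  shows "(\<lambda>d. (norm (S d))\<^sup>2) summable_on D"
proof (rule nonneg_bdd_above_summable_on)
  have "(\<Sum>d\<in>F. (norm (S d))\<^sup>2) \<le> infsum (\<lambda>e. (norm (T e))\<^sup>2) E" if F: "finite F" "F \<subseteq> D" for F
  proof (rule has_sum_mono)
    \<comment> \<open>Parseval in \<open>E\<close> for each \<open>S d\<close>, with the two
      summations exchanged; this is mere additivity because \<open>F\<close> is finite.\<close>
    show "((\<lambda>e. \<Sum>d\<in>F. (cmod (cinner (S d) e))\<^sup>2) has_sum (\<Sum>d\<in>F. (norm (S d))\<^sup>2)) E"
      using F(1) by (induction F rule: finite_induct) (simp_all add: has_sum_add Parseval[OF E])
    show "((\<lambda>e. (norm (T e))\<^sup>2) has_sum infsum (\<lambda>e. (norm (T e))\<^sup>2) E) E"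
      using sq by simp
    fix e
    \<comment> \<open>Transposing the matrix entries turns the sum over \<open>d\<close> into
      Fourier coefficients of \<open>T e\<close>, to which Bessel's inequality in \<open>D\<close>
      applies.\<close>
    have "cmod (cinner (S d) e) = cmod (cinner (T e) d)" for d
      using adj[of e d] cinner_commute[of "S d" e] by simp
    then show "(\<Sum>d\<in>F. (cmod (cinner (S d) e))\<^sup>2) \<le> (norm (T e))\<^sup>2"
      using Bessel_inequality[OF D F, of "T e"] by simp
  qed
  then show "bdd_above (sum (\<lambda>d. (norm (S d))\<^sup>2) ` {F. F \<subseteq> D \<and> finite F})"
    by (auto intro!: bdd_aboveI)
qed auto

text \<open>Membership in \<open>HS_class\<close> provides some basis, whereas
  \<open>trace_op\<close> uses a chosen one. The passage goes from \<open>T\<close> on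
  \<open>E0\<close> to its adjoint on \<open>E\<close>, and back to \<open>T\<close> on
  \<open>E\<close>.\<close>

lemma HS_class_summable:
  assumes "T \<in> HS_class" "is_onb E"
  shows "(\<lambda>e. (norm (T e))\<^sup>2) summable_on E"
proof -
  obtain E0 where T: "bounded_clinear T" and E0: "is_onb E0" "(\<lambda>e. (norm (T e))\<^sup>2) summable_on E0"
    using assms(1) by (auto simp: HS_class_def)
  have E: "orthonormal E"
    using assms(2) by (simp add: is_onb_def)
  have "(\<lambda>e. (norm (cadjoint T e))\<^sup>2) summable_on E"
    by (rule adjoint_square_summable[OF cinner_cadjoint[OF T] E0(1) E E0(2)])
  moreover have "cinner (cadjoint T x) y = cinner x (T y)" for x y
    by (metis cinner_cadjoint[OF T] cinner_commute)
  ultimately show ?thesis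
    using adjoint_square_summable assms(2) E by blast
qed

text \<open>The very basis that \<open>trace_op\<close> selects.\<close>

definition HS_basis :: "'k::complex_hilbert set"
  where "HS_basis = (SOME E. is_onb E)"

lemma is_onb_HS_basis: "is_onb HS_basis"
  unfolding HS_basis_def by (rule someI_ex[OF ex_onb])

lemma HS_inner_eq:
  assumes "S \<in> HS_class"
  shows "HS_inner T S = (\<Sum>\<^sub>\<infinity>e\<in>HS_basis. cinner (T e) (S e))"
proof -
  have S: "bounded_clinear S"
    using assms by (simp add: HS_class_def)
  have "cinner (cadjoint S (T e)) e = cinner (T e) (S e)" for e
    by (metis cinner_cadjoint[OF S] cinner_commute)
  then show ?thesis
    by (simp add: HS_inner_def trace_op_def HS_basis_def)
qed

lemma HS_norm_eq:
  assumes "T \<in> HS_class"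
  shows "HS_norm T = sqrt (\<Sum>\<^sub>\<infinity>e\<in>HS_basis. (norm (T e))\<^sup>2)"
proof -
  have "HS_inner T T = (\<Sum>\<^sub>\<infinity>e\<in>HS_basis. complex_of_real ((norm (T e))\<^sup>2))"
    by (simp only: HS_inner_eq[OF assms] cinner_self)
  also have "\<dots> = complex_of_real (\<Sum>\<^sub>\<infinity>e\<in>HS_basis. (norm (T e))\<^sup>2)"
    using has_sum_bounded_linear[OF bounded_linear_of_real
        has_sum_infsum[OF HS_class_summable[OF assms is_onb_HS_basis]]] by (rule infsumI)
  finally show ?thesis
    by (simp add: HS_norm_def)
qed

lemma HS_norm_power2:
  "T \<in> HS_class \<Longrightarrow> (HS_norm T)\<^sup>2 = (\<Sum>\<^sub>\<infinity>e\<in>HS_basis. (norm (T e))\<^sup>2)"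
  by (simp add: HS_norm_eq infsum_nonneg)

lemma HS_norm_nonneg: "T \<in> HS_class \<Longrightarrow> 0 \<le> HS_norm T"
  by (simp add: HS_norm_eq infsum_nonneg)

text \<open>Cauchy-Schwarz is used twice, for each \<open>e\<close> in the Hilbert space and then
  for the finite sum. The bound is independent of \<open>F\<close>, so it yields absolute
  summability as well as \<open>HS_Cauchy_Schwarz\<close>.\<close>

lemma sum_norm_HS_le:
  assumes T: "T \<in> HS_class" and S: "S \<in> HS_class" and F: "finite F" "F \<subseteq> HS_basis"
  shows "(\<Sum>e\<in>F. cmod (cinner (T e) (S e))) \<le> HS_norm T * HS_norm S"
proof -
  have L2: "L2_set (\<lambda>e. norm (R e)) F \<le> HS_norm R" if R: "R \<in> HS_class" for R :: "'a \<Rightarrow> 'a"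
    using finite_sum_le_infsum[OF HS_class_summable[OF R is_onb_HS_basis] F]
    by (auto simp: L2_set_def HS_norm_power2[OF R, symmetric] HS_norm_nonneg[OF R]
        intro!: real_le_lsqrt sum_nonneg)
  have "(\<Sum>e\<in>F. cmod (cinner (T e) (S e))) \<le> (\<Sum>e\<in>F. \<bar>norm (T e)\<bar> * \<bar>norm (S e)\<bar>)"
    by (intro sum_mono) (simp add: complex_Cauchy_Schwarz)
  also have "\<dots> \<le> L2_set (\<lambda>e. norm (T e)) F * L2_set (\<lambda>e. norm (S e)) F"
    by (rule L2_set_mult_ineq)
  also have "\<dots> \<le> HS_norm T * HS_norm S"
    by (intro mult_mono L2 T S HS_norm_nonneg) auto
  finally show ?thesis .
qed

lemma HS_inner_abs_summable:
  assumes "T \<in> HS_class" "S \<in> HS_class"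
  shows "(\<lambda>e. cmod (cinner (T e) (S e))) summable_on HS_basis"
  by (rule nonneg_bdd_above_summable_on)
    (auto intro!: bdd_aboveI[where M = "HS_norm T * HS_norm S"] sum_norm_HS_le[OF assms])

lemma HS_Cauchy_Schwarz:
  assumes "T \<in> HS_class" "S \<in> HS_class"
  shows "cmod (HS_inner T S) \<le> HS_norm T * HS_norm S"
proof -
  have "cmod (HS_inner T S) \<le> (\<Sum>\<^sub>\<infinity>e\<in>HS_basis. cmod (cinner (T e) (S e)))"
    unfolding HS_inner_eq[OF assms(2)] by (rule norm_infsum_bound[OF HS_inner_abs_summable[OF assms]])
  also have "\<dots> \<le> HS_norm T * HS_norm S"
    by (rule infsum_le_finite_sums[OF HS_inner_abs_summable[OF assms] sum_norm_HS_le[OF assms]])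
  finally show ?thesis .
qed

lemma HS_inner_commute:
  assumes "T \<in> HS_class" "S \<in> HS_class"
  shows "HS_inner T S = cnj (HS_inner S T)"
proof -
  have "cinner (T e) (S e) = cnj (cinner (S e) (T e))" for e
    by (rule cinner_commute)
  then show ?thesis
    by (simp add: HS_inner_eq assms)
qed

section \<open>Adjoints of operators into the Hilbert-Schmidt class\<close>

text \<open>By the Hilbert-Schmidt Cauchy-Schwarz inequality,
  \<open>\<lambda>f. HS_inner (G f) T\<close> is a bounded linear functional, so Riesz
  representation in \<open>'h\<close> provides the vector described by
  \<open>adjoint_HS\<close>.\<close>

lemma HS_inner_adjoint_HS:
  fixes G :: "'h::complex_hilbert \<Rightarrow> 'k::complex_hilbert \<Rightarrow> 'k"
  assumes G: "bounded_clinear_HS G" and T: "T \<in> HS_class"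
  shows "HS_inner (G f) T = cinner f (adjoint_HS G T)"
proof -
  have HS: "\<And>f. G f \<in> HS_class" and add: "\<And>f g. G (f + g) = (\<lambda>x. G f x + G g x)"
    and scale: "\<And>c f. G (c *\<^sub>C f) = (\<lambda>x. c *\<^sub>C G f x)"
    using G by (auto simp: bounded_clinear_HS_def)
  obtain C where C: "\<And>f. HS_norm (G f) \<le> C * norm f"
    using G by (auto simp: bounded_clinear_HS_def)
  have summable: "(\<lambda>e. cinner (G f e) (T e)) summable_on HS_basis" for f
    by (rule abs_summable_summable) (rule HS_inner_abs_summable[OF HS T])
  have hadd: "HS_inner (G (f + g)) T = HS_inner (G f) T + HS_inner (G g) T" for f g
    unfolding HS_inner_eq[OF T] add cinner_add_left
    by (intro infsum_add summable)
  have hscale: "HS_inner (G (c *\<^sub>C f)) T = c * HS_inner (G f) T" for c f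
    unfolding HS_inner_eq[OF T] scale cinner_scaleC_left by (rule infsum_cmult_right')
  have "bounded_linear (\<lambda>f. HS_inner (G f) T)"
  proof (rule bounded_linear_intro[where K = "C * HS_norm T"])
    show "HS_inner (G (r *\<^sub>R f)) T = r *\<^sub>R HS_inner (G f) T" for r f
      using hscale[of "complex_of_real r" f] by (simp add: scaleC_of_real scaleR_conv_of_real)
    show "cmod (HS_inner (G f) T) \<le> norm f * (C * HS_norm T)" for f
    proof -
      have "cmod (HS_inner (G f) T) \<le> HS_norm (G f) * HS_norm T"
        by (rule HS_Cauchy_Schwarz[OF HS T])
      also have "\<dots> \<le> (C * norm f) * HS_norm T"
        by (intro mult_right_mono C HS_norm_nonneg T)
      finally show ?thesis
        by (simp add: mult_ac)
    qed
  qed (rule hadd)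
  then have "bounded_clinear (\<lambda>f. HS_inner (G f) T)"
    by (simp add: bounded_clinear_def hscale scaleC_complex_def)
  then obtain h where h: "\<forall>f. HS_inner (G f) T = cinner f h"
    using Riesz_representation by blast
  have "\<forall>f. HS_inner (G f) T = cinner f (adjoint_HS G T)"
    unfolding adjoint_HS_def
  proof (rule theI[where P = "\<lambda>h. \<forall>f. HS_inner (G f) T = cinner f h", OF h])
    fix h' assume h': "\<forall>f. HS_inner (G f) T = cinner f h'"
    show "h' = h"
      by (rule cinner_right_unique) (simp add: h[rule_format, symmetric] h'[rule_format, symmetric])
  qed
  then show ?thesis
    by blast
qed

subsection \<open>The inequality\<close>

theorem theorem3p7:
  fixes J K :: "'j set"
    and G \<Gamma> :: "'j \<Rightarrow> 'h::complex_hilbert \<Rightarrow> 'k::complex_hilbert \<Rightarrow> 'k"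
    and lam :: real and f :: 'h
  assumes "countable J"
    and "HS_frame J G"
    and "alternate_dual_HS_frame J G \<Gamma>"
    and "0 \<le> lam" and "lam \<le> 1"
    and "K \<subseteq> J"
  shows "(\<lambda>j. HS_inner (\<Gamma> j f) (G j f)) summable_on K \<and>
    (\<lambda>j. HS_inner (\<Gamma> j f) (G j f)) summable_on (J - K) \<and>
    (\<lambda>j. adjoint_HS (G j) (\<Gamma> j f)) summable_on K \<and>
    (\<lambda>j. adjoint_HS (G j) (\<Gamma> j f)) summable_on (J - K) \<and>
    Re (\<Sum>\<^sub>\<infinity>j\<in>J - K. HS_inner (\<Gamma> j f) (G j f))
        + (norm (\<Sum>\<^sub>\<infinity>j\<in>K. adjoint_HS (G j) (\<Gamma> j f)))\<^sup>2
      = Re (\<Sum>\<^sub>\<infinity>j\<in>K. HS_inner (\<Gamma> j f) (G j f))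
        + (norm (\<Sum>\<^sub>\<infinity>j\<in>J - K. adjoint_HS (G j) (\<Gamma> j f)))\<^sup>2 \<and>
    Re (\<Sum>\<^sub>\<infinity>j\<in>K. HS_inner (\<Gamma> j f) (G j f))
        + (norm (\<Sum>\<^sub>\<infinity>j\<in>J - K. adjoint_HS (G j) (\<Gamma> j f)))\<^sup>2
      \<ge> (2 * lam - lam\<^sup>2) * Re (\<Sum>\<^sub>\<infinity>j\<in>K. HS_inner (\<Gamma> j f) (G j f))
        + (1 - lam\<^sup>2) * Re (\<Sum>\<^sub>\<infinity>j\<in>J - K. HS_inner (\<Gamma> j f) (G j f))"
proof -
  let ?a = "\<lambda>j. adjoint_HS (G j) (\<Gamma> j f)"
  let ?h = "\<lambda>j. HS_inner (\<Gamma> j f) (G j f)"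
  have G: "bounded_clinear_HS (G j)" and \<Gamma>: "bounded_clinear_HS (\<Gamma> j)" if "j \<in> J" for j
    using assms that by (auto simp: HS_frame_def alternate_dual_HS_frame_def)
  have a_sum: "(?a has_sum f) J"
    using assms by (auto simp: alternate_dual_HS_frame_def)
  \<comment> \<open>The adjoint relation gives
    \<open>HS_inner (G j f) (\<Gamma> j f) = cinner f (?a j)\<close>; conjugating both sides puts
    the arguments in the required order.\<close>
  have h_eq: "?h j = cinner (?a j) f" if "j \<in> J" for j
  proof -
    have HS: "G j f \<in> HS_class" "\<Gamma> j f \<in> HS_class"
      using G[OF that] \<Gamma>[OF that] by (auto simp: bounded_clinear_HS_def)
    show ?thesis
      using HS_inner_commute[OF HS(2) HS(1)] HS_inner_adjoint_HS[OF G[OF that] HS(2), of f]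
        cinner_commute[of "?a j" f] by simp
  qed
  \<comment> \<open>Unconditional convergence in a Banach space passes to subfamilies.\<close>
  have a_summable: "?a summable_on L" if "L \<subseteq> J" for L
    using a_sum that by (meson has_sum_imp_summable summable_on_subset_banach)
  \<comment> \<open>Pairing with the fixed \<open>f\<close> is continuous and linear, so it commutes
    with the sum; this gives convergence and value at once.\<close>
  have h_sum: "(?h has_sum cinner (infsum ?a L) f) L" if "L \<subseteq> J" for L
  proof -
    have "((\<lambda>j. cinner (?a j) f) has_sum cinner (infsum ?a L) f) L"
      by (rule has_sum_bounded_linear[OF bounded_linear_cinner_left
            has_sum_infsum[OF a_summable[OF that]]])
    then show ?thesis
      using h_eq that by (subst has_sum_cong[where g = "\<lambda>j. cinner (?a j) f"]) auto
  qed
  define u v where "u = infsum ?a K" and "v = infsum ?a (J - K)"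
  have "u + v = infsum ?a (K \<union> (J - K))"
    unfolding u_def v_def
    by (rule infsum_Un_disjoint[symmetric]) (use \<open>K \<subseteq> J\<close> in \<open>auto intro!: a_summable\<close>)
  also have "K \<union> (J - K) = J"
    using \<open>K \<subseteq> J\<close> by auto
  also have "infsum ?a J = f"
    by (rule infsumI[OF a_sum])
  finally have f: "f = u + v" ..
  have hK: "Re (infsum ?h K) = inner u f"
    using infsumI[OF h_sum[OF \<open>K \<subseteq> J\<close>]] by (simp add: u_def Re_cinner)
  have hJK: "Re (infsum ?h (J - K)) = inner v f"
    using infsumI[OF h_sum[of "J - K"]] by (simp add: v_def Re_cinner)
  \<comment> \<open>After \<open>f = u + v\<close> both sides are
    \<open>(norm u)\<^sup>2 + inner u v + (norm v)\<^sup>2\<close>.\<close>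
  have "inner v f + (norm u)\<^sup>2 = inner u f + (norm v)\<^sup>2"
    by (simp add: f power2_norm_eq_inner inner_add_left inner_add_right inner_commute)
  \<comment> \<open>The coefficients of \<open>(norm u)\<^sup>2\<close>,
    \<open>(norm v)\<^sup>2\<close> and \<open>inner u v\<close> are
    \<open>(1 - lam)\<^sup>2\<close>, \<open>lam\<^sup>2\<close> and
    \<open>- 2 * lam * (1 - lam)\<close>, which form a perfect square.\<close>
  moreover have "inner u f + (norm v)\<^sup>2 - ((2 * lam - lam\<^sup>2) * inner u f + (1 - lam\<^sup>2) * inner v f)
      = (norm ((1 - lam) *\<^sub>R u - lam *\<^sub>R v))\<^sup>2"
    unfolding f power2_norm_eq_inner inner_add_left inner_add_right inner_diff_left
      inner_diff_right inner_scaleR_left inner_scaleR_right inner_commute[of v u]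
    by (simp add: power2_eq_square algebra_simps)
  then have "(2 * lam - lam\<^sup>2) * inner u f + (1 - lam\<^sup>2) * inner v f \<le> inner u f + (norm v)\<^sup>2"
    using zero_le_power2[of "norm ((1 - lam) *\<^sub>R u - lam *\<^sub>R v)"] by linarith
  ultimately show ?thesis
    using \<open>K \<subseteq> J\<close> hK hJK
      h_sum[OF \<open>K \<subseteq> J\<close>, THEN has_sum_imp_summable] h_sum[of "J - K", THEN has_sum_imp_summable]
    by (auto simp: u_def v_def intro: a_summable)
qed

end
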